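(* Let $\mathcal{A}$ be a finite family of events in a probability space, regarded as the vertex set of a directed graph $G$, and endowed with a quasi-order $\le$ such that for every $A\in\mathcal{A}$, every $B\in\Gamma(A)$ and every $C\in\mathcal{A}$ with $C\notin\Gamma(A)\cup\{A\}$, $$C\not> B\quad\text{or}\quad C>A.$$ Assume further that there is an assignment of real numbers $0<x_A<1$ ($A\in\mathcal{A}$) such that for every $A\in\mathcal{A}$ and every family $\mathcal{C}\subset\mathcal{A}\setminus\Gamma(A)$ satisfying $C\not>A$ for all $C\in\mathcal{C}$, $$\mathrm{P}\Big(A\,\Big|\,\bigcap_{C\in\mathcal{C}}\bar C\Big)\le x_A\prod_{B\in\Gamma(A)}(1-x_B).$$ Then $$\mathrm{P}\Big(\bigcap_{A_1\in\mathcal{A}_1}\bar A_1\,\Big|\,\bigcap_{A_2\in\mathcal{A}_2}\bar A_2\Big)\ge\prod_{A_1\in\mathcal{A}_1}(1-x_{A_1})$$ for any disjoint families $\mathcal{A}_1,\mathcal{A}_2\subset\mathcal{A}$ such that $A_2\not>A_1$ for all $A_1\in\mathcal{A}_1$, $A_2\in\mathcal{A}_2$. In particular, $$\mathrm{P}\Big(\bigcap_{A\in\mathcal{A}}\bar A\Big)>0.$$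
   Context: $\bar A$ denotes the complement of the event $A$. $\Gamma(A)$ is the set of out-neighbors of $A$ in $G$, i.e. the set of $B$ such that $(A,B)$ is an edge of $G$. A quasi-order is a transitive and reflexive (not necessarily antisymmetric or total) binary relation; $C>A$ means that $A\le C$ holds and $C\le A$ does not, and $C\not>A$ is its negation. Empty intersections are the whole probability space and empty products equal $1$. Inequalities involving a conditional probability are understood for conditioning events of positive probability. *)

theory Defs
  imports "HOL-Probability.Probability" "Graph_Theory.Pair_Digraph"
begin

definition out_nbrs :: "'v pair_pre_digraph \<Rightarrow> 'v \<Rightarrow> 'v set" where
  "out_nbrs G a = {b. (a, b) \<in> parcs G}"

(* (a, b) \<in> R reads "a \<le> b"; strictly_above R c a reads "c > a". *)
definition strictly_above :: "'v rel \<Rightarrow> 'v \<Rightarrow> 'v \<Rightarrow> bool" where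
  "strictly_above R c a \<longleftrightarrow> (a, c) \<in> R \<and> (c, a) \<notin> R"

end

theory Submission
  imports Defs
begin

text \<open>
  Write \<open>Q S\<close> for the probability that no event of \<open>S\<close> occurs. It suffices to show
  \<open>Q (insert a S) \<ge> (1 - x a) * Q S\<close> whenever no element of \<open>S\<close> lies strictly above \<open>a\<close>: the events
  of \<open>\<A>\<^sub>1\<close> can then be moved into \<open>\<A>\<^sub>2\<close> one at a time, always taking an order-minimal one, which
  multiplies up to the product. This one-event inequality goes by induction on \<open>S\<close>. Split \<open>S\<close> into
  \<open>D\<^sub>1 = S \<inter> \<Gamma>(a)\<close> and \<open>D\<^sub>2 = S - \<Gamma>(a)\<close>. The order condition on \<open>G\<close> says precisely that no element
  of \<open>D\<^sub>2\<close> lies strictly above one of \<open>D\<^sub>1\<close>, so the induction hypothesis gives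
  \<open>Q S \<ge> Q D\<^sub>2 * (\<Prod>b\<in>\<Gamma>(a). 1 - x b)\<close>, while the hypothesis on \<open>a\<close> bounds the probability of \<open>E a\<close>
  without \<open>D\<^sub>2\<close> by \<open>x a * (\<Prod>b\<in>\<Gamma>(a). 1 - x b) * Q D\<^sub>2\<close>.
\<close>

lemma exists_minimal_not_strictly_above:
  assumes "finite A" "A \<noteq> {}" "trans R"
  shows "\<exists>m\<in>A. \<forall>y\<in>A. \<not> strictly_above R m y"
proof -
  have "\<exists>m\<in>A. \<forall>y\<in>A. y \<noteq> m \<longrightarrow> \<not> strictly_above R m y"
  proof (rule Finite_Set.bex_min_element[OF \<open>finite A\<close> _ _ \<open>A \<noteq> {}\<close>,
        where R = "\<lambda>y m. strictly_above R m y"])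
    show "asymp_on A (\<lambda>y m. strictly_above R m y)"
      by (auto simp: strictly_above_def intro: asymp_onI)
    show "transp_on A (\<lambda>y m. strictly_above R m y)"
      using \<open>trans R\<close> unfolding strictly_above_def by (intro transp_onI) (meson transD)
  qed
  then show ?thesis
    by (metis strictly_above_def)
qed

text \<open>\<open>Q\<close> and \<open>f\<close> stay abstract because the telescoping serves
  twice: inside the induction for the one-event inequality, and again for the final bound. Asking
  for that inequality only when \<open>T\<close> lies in \<open>S1 \<union> S2 - {a}\<close> lets an
  induction hypothesis about proper subsets supply it.\<close>

lemma prod_le_if_insert_le:
  fixes Q :: "'v set \<Rightarrow> real"
  assumes "trans R"
    and "finite S1" "S1 \<inter> S2 = {}"
    and "\<And>a. a \<in> S1 \<Longrightarrow> f a \<ge> 0"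
    and "\<And>a c. a \<in> S1 \<Longrightarrow> c \<in> S2 \<Longrightarrow> \<not> strictly_above R c a"
    and "\<And>a T. a \<in> S1 \<Longrightarrow> T \<subseteq> S1 \<union> S2 - {a} \<Longrightarrow> (\<And>c. c \<in> T \<Longrightarrow> \<not> strictly_above R c a) \<Longrightarrow>
           f a * Q T \<le> Q (insert a T)"
  shows "(\<Prod>a\<in>S1. f a) * Q S2 \<le> Q (S1 \<union> S2)"
  using assms(2-)
proof (induction "card S1" arbitrary: S1 S2)
  case 0
  then show ?case by simp
next
  case (Suc n)
  then have "S1 \<noteq> {}" by auto
  \<comment> \<open>Minimality preserves the order condition: once \<open>m\<close> joins
    \<open>S2\<close>, it is not strictly above anything left in \<open>S1\<close>.\<close>
  then obtain m where m: "m \<in> S1" "\<And>y. y \<in> S1 \<Longrightarrow> \<not> strictly_above R m y"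
    using exists_minimal_not_strictly_above[OF \<open>finite S1\<close> _ \<open>trans R\<close>] by blast
  let ?S1 = "S1 - {m}" and ?S2 = "insert m S2"
  have union: "?S1 \<union> ?S2 = S1 \<union> S2"
    using m(1) by blast
  have IH: "(\<Prod>a\<in>?S1. f a) * Q ?S2 \<le> Q (S1 \<union> S2)"
  proof (rule Suc(1)[of ?S1 ?S2, unfolded union])
    show "n = card ?S1"
      using Suc(2,3) m(1) by simp
    show "\<not> strictly_above R c a" if "a \<in> ?S1" "c \<in> ?S2" for a c
      using Suc(6) m(2) that by blast
    show "f a * Q T \<le> Q (insert a T)"
      if "a \<in> ?S1" "T \<subseteq> S1 \<union> S2 - {a}" "\<And>c. c \<in> T \<Longrightarrow> \<not> strictly_above R c a" for a T
      using Suc(7) that by blast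
  qed (use Suc(3-5) in auto)
  have "f m * Q S2 \<le> Q ?S2"
    by (rule Suc(7)) (use m(1) Suc(4,6) in auto)
  then have "(\<Prod>a\<in>?S1. f a) * (f m * Q S2) \<le> (\<Prod>a\<in>?S1. f a) * Q ?S2"
    by (intro mult_left_mono prod_nonneg) (use Suc(5) in auto)
  also note IH
  finally show ?case
    using prod.remove[OF \<open>finite S1\<close> m(1), of f] by (simp add: mult_ac)
qed

text \<open>The product form, rather than a conditional probability, also covers
  \<open>Q S = 0\<close>, so the induction never has to track positivity.\<close>

lemma (in prob_space) prob_avoid_insert_ge:
  fixes E :: "'v \<Rightarrow> 'a set" and R :: "'v rel"
  defines "Q \<equiv> \<lambda>S. \<P>(\<omega> in M. \<omega> \<in> (\<Inter>c\<in>S. space M - E c))"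
  assumes "trans R" "finite V"
    and meas: "\<And>a. a \<in> V \<Longrightarrow> E a \<in> events"
    and nbrs: "\<And>a. a \<in> V \<Longrightarrow> N a \<subseteq> V"
    and order: "\<And>a b c. a \<in> V \<Longrightarrow> b \<in> N a \<Longrightarrow> c \<in> V \<Longrightarrow> c \<notin> N a \<union> {a} \<Longrightarrow>
           \<not> strictly_above R c b \<or> strictly_above R c a"
    and x: "\<And>a. a \<in> V \<Longrightarrow> 0 < x a \<and> x a < 1"
    and cond: "\<And>a \<C>. a \<in> V \<Longrightarrow> \<C> \<subseteq> V - N a \<Longrightarrow>
           (\<And>c. c \<in> \<C> \<Longrightarrow> \<not> strictly_above R c a) \<Longrightarrow> Q \<C> > 0 \<Longrightarrow>
           \<P>(\<omega> in M. \<omega> \<in> E a \<bar> \<omega> \<in> (\<Inter>c\<in>\<C>. space M - E c)) \<le> x a * (\<Prod>b\<in>N a. 1 - x b)"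
    and "S \<subseteq> V" "a \<in> V" "a \<notin> S" "\<And>c. c \<in> S \<Longrightarrow> \<not> strictly_above R c a"
  shows "(1 - x a) * Q S \<le> Q (insert a S)"
proof -
  define F where "F S = {\<omega> \<in> space M. \<omega> \<in> (\<Inter>c\<in>S. space M - E c)}" for S
  have Q_F: "Q S = prob (F S)" for S
    by (simp add: Q_def F_def)
  have F_events: "F S \<in> events" if "S \<subseteq> V" for S
  proof -
    have "F S = space M - (\<Union>c\<in>S. E c)"
      by (auto simp: F_def)
    moreover have "finite S"
      using that \<open>finite V\<close> finite_subset by blast
    ultimately show ?thesis
      using that meas by (auto intro!: sets.Diff sets.finite_UN)
  qed
  have "finite S"
    using \<open>S \<subseteq> V\<close> \<open>finite V\<close> finite_subset by blast
  then show ?thesis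
    using assms(9-)
  proof (induction S arbitrary: a rule: finite_psubset_induct)
    case (psubset S)
    let ?D1 = "S \<inter> N a" and ?D2 = "S - N a"
    let ?p = "\<Prod>b\<in>N a. 1 - x b"
    note nbrs_a = nbrs[OF \<open>a \<in> V\<close>]
    have fin_nbrs: "finite (N a)"
      using nbrs_a \<open>finite V\<close> finite_subset by blast
    have "(\<Prod>b\<in>?D1. 1 - x b) * Q ?D2 \<le> Q (?D1 \<union> ?D2)"
    proof (rule prod_le_if_insert_le[OF \<open>trans R\<close>])
      \<comment> \<open>The alternative \<open>c > a\<close> of the order condition is excluded
        because \<open>c\<close> lies in \<open>S\<close>; \<open>c \<noteq> a\<close> follows from
        \<open>a \<notin> S\<close>.\<close>
      show "\<not> strictly_above R c b" if "b \<in> ?D1" "c \<in> ?D2" for b c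
        using order[of a b c] that psubset.prems by auto
      \<comment> \<open>\<open>T\<close> omits \<open>b\<close>, an element of \<open>S\<close>, so
        it is a proper subset and the induction hypothesis applies with \<open>b\<close> in place of
        \<open>a\<close>.\<close>
      show "(1 - x b) * Q T \<le> Q (insert b T)"
        if "b \<in> ?D1" "T \<subseteq> ?D1 \<union> ?D2 - {b}" "\<And>c. c \<in> T \<Longrightarrow> \<not> strictly_above R c b" for b T
        by (rule psubset.IH) (use that psubset.prems in auto)
    qed (use \<open>finite S\<close> psubset.prems x in \<open>auto simp: less_imp_le\<close>)
    moreover have "?D1 \<union> ?D2 = S" by blast
    ultimately have D1: "(\<Prod>b\<in>?D1. 1 - x b) * Q ?D2 \<le> Q S"
      by simp
    \<comment> \<open>Neighbors outside \<open>S\<close> contribute only factors at most 1.\<close>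
    have "?p = (\<Prod>b\<in>N a - ?D1. 1 - x b) * (\<Prod>b\<in>?D1. 1 - x b)"
      by (rule prod.subset_diff[OF _ fin_nbrs]) blast
    also have "\<dots> \<le> 1 * (\<Prod>b\<in>?D1. 1 - x b)"
      by (intro mult_right_mono prod_le_1 prod_nonneg) (use nbrs_a x in \<open>auto simp: less_imp_le\<close>)
    finally have "?p * Q ?D2 \<le> (\<Prod>b\<in>?D1. 1 - x b) * Q ?D2"
      by (intro mult_right_mono) (simp_all add: Q_F)
    with D1 have D2: "?p * Q ?D2 \<le> Q S"
      by linarith
    have D2_events: "F ?D2 \<in> events" and S_events: "F S \<in> events"
      using F_events psubset.prems(1) by blast+
    note E_events = meas[OF \<open>a \<in> V\<close>]
    have "prob (E a \<inter> F ?D2) \<le> x a * ?p * Q ?D2"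
    proof (cases "Q ?D2 = 0")
      case True
      have "prob (E a \<inter> F ?D2) \<le> prob (F ?D2)"
        by (rule finite_measure_mono) (use D2_events in auto)
      with True show ?thesis by (simp add: Q_F)
    next
      case False
      then have pos: "Q ?D2 > 0"
        using measure_nonneg[of M "F ?D2"] by (simp add: Q_F less_le)
      have "\<P>(\<omega> in M. \<omega> \<in> E a \<bar> \<omega> \<in> (\<Inter>c\<in>?D2. space M - E c)) \<le> x a * ?p"
        by (rule cond) (use psubset.prems pos in auto)
      moreover have "E a \<inter> F ?D2 = {\<omega> \<in> space M. \<omega> \<in> E a \<and> \<omega> \<in> (\<Inter>c\<in>?D2. space M - E c)}"
        using sets.sets_into_space[OF E_events] by (auto simp: F_def)
      ultimately have "prob (E a \<inter> F ?D2) / Q ?D2 \<le> x a * ?p"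
        by (simp add: cond_prob_def Q_def)
      with pos show ?thesis
        by (simp add: divide_le_eq)
    qed
    \<comment> \<open>Shrinking \<open>S\<close> to \<open>?D2\<close> enlarges the event to one
      already bounded. Via \<open>D2\<close> the bound becomes \<open>x a * Q S\<close>, and
      subtracting it from \<open>Q S\<close> leaves the factor \<open>1 - x a\<close>.\<close>
    moreover have "prob (E a \<inter> F S) \<le> prob (E a \<inter> F ?D2)"
    proof (rule finite_measure_mono)
      show "E a \<inter> F S \<subseteq> E a \<inter> F ?D2"
        by (auto simp: F_def)
    qed (rule sets.Int[OF E_events D2_events])
    moreover have "x a * (?p * Q ?D2) \<le> x a * Q S"
      using D2 x[OF \<open>a \<in> V\<close>] by (intro mult_left_mono) auto
    moreover have "F (insert a S) = F S - E a \<inter> F S"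
      by (auto simp: F_def)
    then have "Q (insert a S) = Q S - prob (E a \<inter> F S)"
      using finite_measure_Diff[OF S_events, of "E a \<inter> F S"] E_events S_events by (simp add: Q_F sets.Int)
    ultimately show ?case
      by (simp add: algebra_simps)
  qed
qed

theorem theorem3p1:
  fixes M :: "'a measure"
    and G :: "'v pair_pre_digraph"
    and E :: "'v \<Rightarrow> 'a set"
    and R :: "'v rel"
    and x :: "'v \<Rightarrow> real"
  assumes "prob_space M"
    and "pair_fin_digraph G"
    and "\<And>a. a \<in> pverts G \<Longrightarrow> E a \<in> sets M"
    and "preorder_on (pverts G) R"
    and "\<And>a b c. a \<in> pverts G \<Longrightarrow> b \<in> out_nbrs G a \<Longrightarrow> c \<in> pverts G \<Longrightarrow>
           c \<notin> out_nbrs G a \<union> {a} \<Longrightarrow> \<not> strictly_above R c b \<or> strictly_above R c a"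
    and "\<And>a. a \<in> pverts G \<Longrightarrow> 0 < x a \<and> x a < 1"
    and "\<And>a \<C>. a \<in> pverts G \<Longrightarrow> \<C> \<subseteq> pverts G - out_nbrs G a \<Longrightarrow>
           (\<And>c. c \<in> \<C> \<Longrightarrow> \<not> strictly_above R c a) \<Longrightarrow>
           \<P>(\<omega> in M. \<omega> \<in> (\<Inter>c\<in>\<C>. space M - E c)) > 0 \<Longrightarrow>
           \<P>(\<omega> in M. \<omega> \<in> E a \<bar> \<omega> \<in> (\<Inter>c\<in>\<C>. space M - E c))
             \<le> x a * (\<Prod>b\<in>out_nbrs G a. 1 - x b)"
  shows "(\<forall>\<A>\<^sub>1 \<A>\<^sub>2. \<A>\<^sub>1 \<subseteq> pverts G \<longrightarrow> \<A>\<^sub>2 \<subseteq> pverts G \<longrightarrow> \<A>\<^sub>1 \<inter> \<A>\<^sub>2 = {} \<longrightarrow>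
            (\<forall>a\<^sub>1\<in>\<A>\<^sub>1. \<forall>a\<^sub>2\<in>\<A>\<^sub>2. \<not> strictly_above R a\<^sub>2 a\<^sub>1) \<longrightarrow>
            \<P>(\<omega> in M. \<omega> \<in> (\<Inter>a\<in>\<A>\<^sub>2. space M - E a)) > 0 \<longrightarrow>
            \<P>(\<omega> in M. \<omega> \<in> (\<Inter>a\<in>\<A>\<^sub>1. space M - E a) \<bar> \<omega> \<in> (\<Inter>a\<in>\<A>\<^sub>2. space M - E a))
              \<ge> (\<Prod>a\<in>\<A>\<^sub>1. 1 - x a))
         \<and> \<P>(\<omega> in M. \<omega> \<in> (\<Inter>a\<in>pverts G. space M - E a)) > 0"
proof -
  interpret prob_space M by fact
  interpret pair_fin_digraph G by fact
  let ?V = "pverts G"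
  define Q where "Q S = \<P>(\<omega> in M. \<omega> \<in> (\<Inter>c\<in>S. space M - E c))" for S
  have "trans R"
    using assms(4) by (simp add: preorder_on_def)
  have nbrs: "out_nbrs G a \<subseteq> ?V" for a
    by (auto simp: out_nbrs_def dest: in_arcsD2)
  have insert_ge: "(1 - x a) * Q S \<le> Q (insert a S)"
    if "S \<subseteq> ?V" "a \<in> ?V" "a \<notin> S" "\<And>c. c \<in> S \<Longrightarrow> \<not> strictly_above R c a" for a S
    unfolding Q_def
    by (rule prob_avoid_insert_ge[where N = "out_nbrs G", OF \<open>trans R\<close> pair_finite_verts assms(3) nbrs
          assms(5,6,7) that])
  have union_ge: "(\<Prod>a\<in>S1. 1 - x a) * Q S2 \<le> Q (S1 \<union> S2)"
    if S: "S1 \<subseteq> ?V" "S2 \<subseteq> ?V" "S1 \<inter> S2 = {}"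
      and above: "\<And>a c. a \<in> S1 \<Longrightarrow> c \<in> S2 \<Longrightarrow> \<not> strictly_above R c a" for S1 S2
  proof (rule prod_le_if_insert_le[OF \<open>trans R\<close> _ S(3) _ above])
    show "finite S1"
      using S(1) pair_finite_verts finite_subset by blast
    show "0 \<le> 1 - x a" if "a \<in> S1" for a
      using assms(6)[of a] that S(1) by auto
    show "(1 - x a) * Q T \<le> Q (insert a T)"
      if "a \<in> S1" "T \<subseteq> S1 \<union> S2 - {a}" "\<And>c. c \<in> T \<Longrightarrow> \<not> strictly_above R c a" for a T
      by (rule insert_ge) (use that S in auto)
  qed
  have "(\<Prod>a\<in>S1. 1 - x a)
      \<le> \<P>(\<omega> in M. \<omega> \<in> (\<Inter>a\<in>S1. space M - E a) \<bar> \<omega> \<in> (\<Inter>a\<in>S2. space M - E a))"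
    if S: "S1 \<subseteq> ?V" "S2 \<subseteq> ?V" "S1 \<inter> S2 = {}" "\<forall>a\<in>S1. \<forall>c\<in>S2. \<not> strictly_above R c a"
      and pos: "\<P>(\<omega> in M. \<omega> \<in> (\<Inter>a\<in>S2. space M - E a)) > 0" for S1 S2
  proof -
    have "(\<Prod>a\<in>S1. 1 - x a) \<le> Q (S1 \<union> S2) / Q S2"
      using union_ge[of S1 S2] S pos by (simp add: Q_def le_divide_eq)
    also have "Q (S1 \<union> S2)
        = \<P>(\<omega> in M. \<omega> \<in> (\<Inter>a\<in>S1. space M - E a) \<and> \<omega> \<in> (\<Inter>a\<in>S2. space M - E a))"
      unfolding Q_def by (intro arg_cong[where f = prob]) auto
    finally show ?thesis
      by (simp add: cond_prob_def Q_def)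
  qed
  moreover have "Q ?V > 0"
  proof -
    have "0 < (\<Prod>a\<in>?V. 1 - x a)"
      by (rule prod_pos) (use assms(6) in auto)
    \<comment> \<open>With nothing to avoid, the event is the whole space, so
      \<open>Q {} = 1\<close>.\<close>
    also have "\<dots> \<le> Q ?V"
      using union_ge[of ?V "{}"] by (simp add: Q_def prob_space)
    finally show ?thesis .
  qed
  ultimately show ?thesis
    unfolding Q_def by blast
qed

end
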